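(* For every integer $s\ge 3$, every co-locally $(s-1)$-colourable graph $G \neq K_s$ of chromatic number $\chi < \frac{5s+2}{3}$ satisfies $\varphi(G) \ge \chi - s + 1$.
   Context: All graphs are finite, simple and non-empty. A graph $G$ is co-locally $t$-colourable if for every vertex $v$ and every vertex $u\neq v$, $\chi(G[\{u\}\cup N(v)])\le t$, where $N(v)$ is the open neighbourhood. For a proper colouring $\sigma$ of $G$, $\varphi_\sigma(G)=\max_{H}\big(|\sigma(V(H))|-\chi(H)\big)$ over all induced subgraphs $H$ of $G$, and $\varphi(G)=\min_\sigma\varphi_\sigma(G)$ over all proper colourings. *)

theory Defs
  imports "Graph_Theory.Graph_Theory"
begin

text \<open>
  The library locale predicate \<^const>\<open>graph\<close> (finite, symmetric, without loops and without parallel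
  arcs) describes finite simple graphs: each edge is a pair of opposite arcs, and adjacency of
  \<open>u\<close> and \<open>v\<close> is \<open>u \<rightarrow>\<^bsub>G\<^esub> v\<close>. It admits the empty vertex set, so non-emptiness is always
  required separately.
\<close>

definition proper_colouring :: "('a, 'b) pre_digraph \<Rightarrow> ('a \<Rightarrow> nat) \<Rightarrow> bool" where
  "proper_colouring G \<sigma> \<longleftrightarrow> (\<forall>u\<in>verts G. \<forall>v\<in>verts G. u \<rightarrow>\<^bsub>G\<^esub> v \<longrightarrow> \<sigma> u \<noteq> \<sigma> v)"

definition colourable :: "nat \<Rightarrow> ('a, 'b) pre_digraph \<Rightarrow> bool" where
  "colourable k G \<longleftrightarrow> (\<exists>\<sigma>. proper_colouring G \<sigma> \<and> \<sigma> ` verts G \<subseteq> {..<k})"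

definition chromatic_number :: "('a, 'b) pre_digraph \<Rightarrow> nat" where
  "chromatic_number G = (LEAST k. colourable k G)"

definition neighbourhood :: "('a, 'b) pre_digraph \<Rightarrow> 'a \<Rightarrow> 'a set" where
  "neighbourhood G v = {w \<in> verts G. v \<rightarrow>\<^bsub>G\<^esub> w}"

definition co_locally_colourable :: "nat \<Rightarrow> ('a, 'b) pre_digraph \<Rightarrow> bool" where
  "co_locally_colourable t G \<longleftrightarrow>
     (\<forall>v\<in>verts G. \<forall>u\<in>verts G. u \<noteq> v \<longrightarrow>
        chromatic_number (G \<restriction> ({u} \<union> neighbourhood G v)) \<le> t)"

definition phi_colouring :: "('a, 'b) pre_digraph \<Rightarrow> ('a \<Rightarrow> nat) \<Rightarrow> int" where
  "phi_colouring G \<sigma> =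
     Max {int (card (\<sigma> ` verts H)) - int (chromatic_number H) | H.
            induced_subgraph H G \<and> verts H \<noteq> {}}"

definition phi :: "('a, 'b) pre_digraph \<Rightarrow> int" where
  "phi G = Min {phi_colouring G \<sigma> | \<sigma>. proper_colouring G \<sigma>}"

text \<open>
  \<^const>\<open>Max\<close> and \<^const>\<open>Min\<close> are unspecified on infinite or empty sets. The following facts show that
  they are applied only to finite non-empty sets when \<open>G\<close> is a non-empty finite graph.
\<close>

lemma ex_proper_colouring:
  assumes "graph G"
  shows "\<exists>\<sigma>. proper_colouring G \<sigma> \<and> \<sigma> ` verts G \<subseteq> {..<card (verts G)}"
proof -
  interpret graph G by fact
  obtain \<sigma> where "bij_betw \<sigma> (verts G) {0..<card (verts G)}"
    using ex_bij_betw_finite_nat[OF finite_verts] by blast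
  then have "inj_on \<sigma> (verts G)" and "\<sigma> ` verts G \<subseteq> {..<card (verts G)}"
    by (auto simp: bij_betw_def)
  moreover have "proper_colouring G \<sigma>"
    unfolding proper_colouring_def using \<open>inj_on \<sigma> (verts G)\<close> by (metis adj_not_same inj_onD)
  ultimately show ?thesis by blast
qed

lemma chromatic_number_le_card:
  assumes "graph G"
  shows "chromatic_number G \<le> card (verts G)"
  unfolding chromatic_number_def
  using ex_proper_colouring[OF assms] by (intro Least_le) (simp add: colourable_def)

lemma finite_induced_subgraphs:
  assumes "graph G"
  shows "finite {H. induced_subgraph H G}"
proof -
  interpret graph G by fact
  have "H = G \<restriction> verts H \<and> verts H \<subseteq> verts G" if "induced_subgraph H G" for H
    using that
    by (auto simp: induced_subgraph_def subgraph_def compatible_def induce_subgraph_def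
        intro!: pre_digraph.equality)
  then have "{H. induced_subgraph H G} \<subseteq> (\<lambda>S. G \<restriction> S) ` Pow (verts G)"
    by blast
  then show ?thesis
    by (rule finite_subset) simp
qed

lemma induced_subgraph_graph:
  assumes "graph G" and "induced_subgraph H G"
  shows "graph H"
proof -
  interpret graph G by fact
  show ?thesis
    using digraphI_induced[OF assms(2)] induced_graph_imp_graph[OF assms(2)]
    by (simp add: graph_def pseudo_graph_def digraph_def)
qed

lemma phi_colouring_set:
  assumes "graph G" and "verts G \<noteq> {}"
  defines "D \<equiv> \<lambda>\<sigma>. {int (card (\<sigma> ` verts H)) - int (chromatic_number H) | H.
            induced_subgraph H G \<and> verts H \<noteq> {}}"
  shows "finite (D \<sigma>)" and "D \<sigma> \<noteq> {}" and "D \<sigma> \<subseteq> {- int (card (verts G))..int (card (verts G))}"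
proof -
  interpret graph G by fact
  have "D \<sigma> \<subseteq> (\<lambda>H. int (card (\<sigma> ` verts H)) - int (chromatic_number H)) ` {H. induced_subgraph H G}"
    by (auto simp: D_def)
  then show "finite (D \<sigma>)"
    using finite_induced_subgraphs[OF assms(1)] by (meson finite_imageI finite_subset)
  have "induced_subgraph G G"
    by (auto simp: induced_subgraph_def subgraph_def compatible_def wf_digraph)
  then show "D \<sigma> \<noteq> {}"
    using assms(2) by (auto simp: D_def)
  have "- int (card (verts G)) \<le> int (card (\<sigma> ` verts H)) - int (chromatic_number H)
      \<and> int (card (\<sigma> ` verts H)) - int (chromatic_number H) \<le> int (card (verts G))"
    if H: "induced_subgraph H G" for H
  proof -
    have sub: "verts H \<subseteq> verts G"
      using H by (auto simp: induced_subgraph_def subgraph_def)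
    then have "card (verts H) \<le> card (verts G)" and "finite (verts H)"
      by (auto intro: card_mono finite_subset)
    moreover have "card (\<sigma> ` verts H) \<le> card (verts H)"
      using \<open>finite (verts H)\<close> by (rule card_image_le)
    moreover have "chromatic_number H \<le> card (verts H)"
      using induced_subgraph_graph[OF assms(1) H] by (rule chromatic_number_le_card)
    ultimately show ?thesis by linarith
  qed
  then show "D \<sigma> \<subseteq> {- int (card (verts G))..int (card (verts G))}"
    by (auto simp: D_def)
qed

lemma phi_set:
  assumes "graph G" and "verts G \<noteq> {}"
  shows "finite {phi_colouring G \<sigma> | \<sigma>. proper_colouring G \<sigma>}"
    and "{phi_colouring G \<sigma> | \<sigma>. proper_colouring G \<sigma>} \<noteq> {}"
proof -
  have "phi_colouring G \<sigma> \<in> {- int (card (verts G))..int (card (verts G))}" for \<sigma>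
    unfolding phi_colouring_def
    using Max_in[OF phi_colouring_set(1,2)[OF assms, of \<sigma>]] phi_colouring_set(3)[OF assms, of \<sigma>]
    by blast
  then have "{phi_colouring G \<sigma> | \<sigma>. proper_colouring G \<sigma>}
      \<subseteq> {- int (card (verts G))..int (card (verts G))}"
    by blast
  then show "finite {phi_colouring G \<sigma> | \<sigma>. proper_colouring G \<sigma>}"
    by (rule finite_subset) simp
  show "{phi_colouring G \<sigma> | \<sigma>. proper_colouring G \<sigma>} \<noteq> {}"
    using ex_proper_colouring[OF assms(1)] by blast
qed

end

theory Submission
  imports Defs
begin

text \<open>
  Suppose a proper colouring \<open>\<sigma>\<close> with \<open>k \<ge> \<chi>\<close> colours violates the bound. If \<open>k = \<chi>\<close>, each colour class
  contains a vertex \<open>v\<close> whose neighbours carry all other colours (otherwise the class could be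
  recoloured away). A second vertex \<open>u\<close> of the class would make \<open>{u} \<union> N(v)\<close> a violating set, so all
  classes are singletons and \<open>G\<close> is complete.

  If \<open>k > \<chi>\<close>, take a transversal \<open>T\<close> of the colour classes. It has chromatic number at least
  \<open>k - \<chi> + s\<close>, and \<open>\<chi> < (5 s + 2) / 3\<close> makes this larger than \<open>3 |T| / 5\<close>. A graph with fewer than
  \<open>5/3\<close> times as many vertices as its chromatic number \<open>c\<close> has a vertex whose neighbourhood has
  chromatic number at least \<open>c - 1\<close>: here this exceeds \<open>s - 1\<close>. To see it, apply Hall's theorem to
  the map sending a vertex to its non-neighbours. If Hall's condition holds, the complement is
  covered by disjoint edges and cycles, which gives a colouring with at most \<open>3 n / 5\<close> colours
  (the extremal case being a 5-cycle). Otherwise, a set of maximal deficiency yields a clique each of whose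
  vertices has the required property.
\<close>

section \<open>Hall's marriage theorem\<close>

text \<open>Induction on the size of \<open>I\<close>. If some non-empty proper subset
  \<open>J\<close> is tight, \<open>J\<close> is matched inside its own union and
  \<open>I - J\<close> outside it. If every such subset has slack, one index may take any element of
  its set.\<close>

lemma hall_marriage:
  fixes A :: "'i \<Rightarrow> 'a set"
  assumes "finite I" and "\<And>i. i \<in> I \<Longrightarrow> finite (A i)"
    and "\<And>J. J \<subseteq> I \<Longrightarrow> card J \<le> card (\<Union>(A ` J))"
  shows "\<exists>f. inj_on f I \<and> (\<forall>i\<in>I. f i \<in> A i)"
  using assms
proof (induction "card I" arbitrary: I A rule: less_induct)
  case less
  have finU: "finite (\<Union>(A ` J))" if "J \<subseteq> I" for J
    using less.prems(1,2) that by (meson finite_UN finite_subset subsetD)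
  consider (empty) "I = {}"
    | (tight) J where "J \<noteq> {}" "J \<subset> I" "card (\<Union>(A ` J)) = card J"
    | (slack) "I \<noteq> {}" "\<And>J. J \<noteq> {} \<Longrightarrow> J \<subset> I \<Longrightarrow> card J < card (\<Union>(A ` J))"
    using less.prems(3) by (metis order_le_less psubset_imp_subset)
  then show ?case
  proof cases
    case empty
    then show ?thesis by simp
  next
    case tight
    let ?U = "\<Union>(A ` J)"
    have finJ: "finite J" and cardJ: "card J < card I" and cardIJ: "card (I - J) < card I"
      using tight less.prems(1)
      by (auto simp: finite_subset psubset_card_mono intro!: psubset_card_mono)
    have fU: "finite ?U"
      using tight by (intro finU) auto
    obtain f where f: "inj_on f J" "\<forall>i\<in>J. f i \<in> A i"
      using less.hyps[OF cardJ, of A] tight(2) less.prems finJ by (metis psubset_imp_subset subset_iff subset_trans)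
    \<comment> \<open>\<open>J' \<union> J\<close> reaches at least \<open>card J' + card J\<close>
      elements, and the tight union \<open>?U\<close> accounts for only \<open>card J\<close> of
      them.\<close>
    have hall': "card J' \<le> card (\<Union>((\<lambda>i. A i - ?U) ` J'))" if J': "J' \<subseteq> I - J" for J'
    proof -
      have "card J' + card J = card (J' \<union> J)"
        using J' finJ less.prems(1) by (subst card_Un_disjoint) (auto intro: finite_subset)
      also have "\<dots> \<le> card (\<Union>(A ` (J' \<union> J)))"
        using J' tight by (intro less.prems(3)) auto
      also have "\<Union>(A ` (J' \<union> J)) = \<Union>((\<lambda>i. A i - ?U) ` J') \<union> ?U"
        by auto
      also have "card \<dots> \<le> card (\<Union>((\<lambda>i. A i - ?U) ` J')) + card ?U"
        by (rule card_Un_le)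
      finally show ?thesis
        using tight by simp
    qed
    obtain g where g: "inj_on g (I - J)" "\<forall>i\<in>I - J. g i \<in> A i - ?U"
      using less.hyps[OF cardIJ, of "\<lambda>i. A i - ?U"] less.prems(1,2) hall' by auto
    have "f ` J \<subseteq> ?U"
      using f(2) by auto
    moreover have "g ` (I - J) \<inter> ?U = {}"
      using g(2) by auto
    ultimately have "f ` J \<inter> g ` (I - J) = {}"
      by blast
    then have "inj_on (\<lambda>i. if i \<in> J then f i else g i) (J \<union> (I - J))"
      using f(1) g(1) by (intro inj_on_disjoint_Un)
    moreover have "J \<union> (I - J) = I"
      using tight(2) by blast
    moreover have "\<forall>i\<in>I. (if i \<in> J then f i else g i) \<in> A i"
      using f(2) g(2) by simp
    ultimately show ?thesis
      by (intro exI[of _ "\<lambda>i. if i \<in> J then f i else g i"]) simp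
  next
    case slack
    then obtain i where i: "i \<in> I" by blast
    have "A i \<noteq> {}"
      using less.prems(3)[of "{i}"] i by auto
    then obtain a where a: "a \<in> A i"
      by blast
    have cardI: "card (I - {i}) < card I"
      using i less.prems(1) by (rule card_Diff1_less[rotated])
    \<comment> \<open>The strict inequality of the slack case pays for the loss of
      \<open>a\<close>.\<close>
    have hall': "card J \<le> card (\<Union>((\<lambda>j. A j - {a}) ` J))" if J: "J \<subseteq> I - {i}" for J
    proof (cases "J = {}")
      case False
      then have "card J < card (\<Union>(A ` J))"
        using J i by (intro slack(2)) auto
      moreover have "\<Union>((\<lambda>j. A j - {a}) ` J) = \<Union>(A ` J) - {a}"
        by auto
      moreover have "finite (\<Union>(A ` J))"
        using J by (intro finU) auto
      ultimately show ?thesis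
        by (auto simp: card_Diff_singleton_if)
    qed simp
    obtain g where g: "inj_on g (I - {i})" "\<forall>j\<in>I - {i}. g j \<in> A j - {a}"
      using less.hyps[OF cardI, of "\<lambda>j. A j - {a}"] less.prems(1,2) hall' by auto
    have "inj_on (g(i := a)) I"
      using g unfolding inj_on_def by auto
    moreover have "\<forall>j\<in>I. (g(i := a)) j \<in> A j"
      using g a by auto
    ultimately show ?thesis by blast
  qed
qed

section \<open>Colourings of vertex sets\<close>

text \<open>Colours are counted instead of bounded in value, so colourings can be restricted or
  recoded without renumbering. A bare relation on sets avoids forming induced subgraphs.\<close>

definition set_colourable :: "('a \<Rightarrow> 'a \<Rightarrow> bool) \<Rightarrow> nat \<Rightarrow> 'a set \<Rightarrow> bool" where
  "set_colourable E k S \<longleftrightarrow>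
     (\<exists>f::'a \<Rightarrow> nat. (\<forall>u\<in>S. \<forall>v\<in>S. E u v \<longrightarrow> f u \<noteq> f v) \<and> card (f ` S) \<le> k)"

lemma set_colourable_mono:
  assumes "set_colourable E k S" and "finite S" and "T \<subseteq> S" and "k \<le> l"
  shows "set_colourable E l T"
proof -
  obtain f :: "'a \<Rightarrow> nat" where f: "\<forall>u\<in>S. \<forall>v\<in>S. E u v \<longrightarrow> f u \<noteq> f v" "card (f ` S) \<le> k"
    using assms(1) by (auto simp: set_colourable_def)
  have "card (f ` T) \<le> card (f ` S)"
    using assms by (intro card_mono) auto
  then show ?thesis
    unfolding set_colourable_def using f assms by (intro exI[of _ f]) auto
qed

lemma set_colourable_Un:
  assumes "set_colourable E k S" and "set_colourable E l T" and "finite T"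
  shows "set_colourable E (k + l) (S \<union> T)"
proof -
  obtain f g :: "'a \<Rightarrow> nat"
    where f: "\<forall>u\<in>S. \<forall>v\<in>S. E u v \<longrightarrow> f u \<noteq> f v" "card (f ` S) \<le> k"
      and g: "\<forall>u\<in>T. \<forall>v\<in>T. E u v \<longrightarrow> g u \<noteq> g v" "card (g ` T) \<le> l"
    using assms by (auto simp: set_colourable_def)
  \<comment> \<open>Even and odd numbers keep the two palettes disjoint.\<close>
  define h where "h = (\<lambda>u. if u \<in> S then 2 * f u else 2 * g u + 1)"
  have "h u \<noteq> h v" if "u \<in> S \<union> T" "v \<in> S \<union> T" "E u v" for u v
    using that f g by (auto simp: h_def) presburger+
  moreover have "card (h ` (S \<union> T)) \<le> k + l"
  proof -
    have "h ` (S \<union> T) = (*) 2 ` f ` S \<union> (\<lambda>n. 2 * n + 1) ` g ` (T - S)"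
      by (auto simp: h_def image_iff)
    then have "card (h ` (S \<union> T)) \<le> card ((*) 2 ` f ` S) + card ((\<lambda>n. 2 * n + 1) ` g ` (T - S))"
      by (metis card_Un_le)
    moreover have "card ((*) (2::nat) ` f ` S) = card (f ` S)"
      by (intro card_image) (auto simp: inj_on_def)
    moreover have "card ((\<lambda>n. 2 * n + 1) ` g ` (T - S)) = card (g ` (T - S))"
      by (intro card_image) (auto simp: inj_on_def)
    moreover have "card (g ` (T - S)) \<le> card (g ` T)"
      using assms by (intro card_mono) auto
    ultimately show ?thesis
      using f g by linarith
  qed
  ultimately show ?thesis
    unfolding set_colourable_def by blast
qed

lemma set_colourable_card: "finite S \<Longrightarrow> irreflp E \<Longrightarrow> set_colourable E (card S) S"
proof -
  assume S: "finite S" and "irreflp E"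
  obtain f where "bij_betw f S {0..<card S}"
    using ex_bij_betw_finite_nat[OF S] by blast
  then show ?thesis
    unfolding set_colourable_def using \<open>irreflp E\<close>
    by (intro exI[of _ f]) (auto simp: bij_betw_def inj_on_def irreflp_def)
qed

text \<open>Every vertex of the clique \<open>K\<close> needs a colour of its own, and none of these
  colours can occur on \<open>Z\<close>.\<close>

lemma set_colourable_join:
  assumes "set_colourable E j (K \<union> Z)" and "finite K" and "finite Z" and "K \<inter> Z = {}"
    and "\<And>x y. x \<in> K \<Longrightarrow> y \<in> K \<union> Z \<Longrightarrow> x \<noteq> y \<Longrightarrow> E x y"
  shows "card K \<le> j" and "set_colourable E (j - card K) Z"
proof -
  obtain f :: "'a \<Rightarrow> nat"
    where f: "\<forall>u\<in>K \<union> Z. \<forall>v\<in>K \<union> Z. E u v \<longrightarrow> f u \<noteq> f v" "card (f ` (K \<union> Z)) \<le> j"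
    using assms(1) by (auto simp: set_colourable_def)
  have "inj_on f K"
    using f assms(5) by (auto simp: inj_on_def)
  moreover have "f ` K \<inter> f ` Z = {}"
    using f assms(4,5) by fastforce
  ultimately have "card (f ` (K \<union> Z)) = card K + card (f ` Z)"
    using assms(2,3) by (simp add: image_Un card_Un_disjoint card_image)
  with f show "card K \<le> j" "set_colourable E (j - card K) Z"
    unfolding set_colourable_def by (auto intro!: exI[of _ f])
qed

text \<open>Each \<open>w\<close> shares the colour of its non-neighbour \<open>f w\<close>. As
  \<open>f\<close> is injective, a colour class is a vertex of \<open>K\<close> with at most one
  vertex of \<open>W\<close>.\<close>

lemma set_colourable_matched:
  assumes "finite K" and "irreflp E" and "symp E"
    and "inj_on f W" and "\<And>w. w \<in> W \<Longrightarrow> f w \<in> K \<and> \<not> E (f w) w"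
    and "K \<inter> W = {}"
  shows "set_colourable E (card K) (K \<union> W)"
proof -
  obtain c where c: "bij_betw c K {0..<card K}"
    using ex_bij_betw_finite_nat[OF assms(1)] by blast
  define h where "h = (\<lambda>x. if x \<in> K then c x else c (f x))"
  have inj: "inj_on c K"
    using c by (simp add: bij_betw_def)
  have "\<not> E u v" if uv: "u \<in> K \<union> W" "v \<in> K \<union> W" "h u = h v" for u v
  proof -
    have "u = v \<or> u = f v \<and> v \<in> W \<or> v = f u \<and> u \<in> W"
      using uv inj assms(4,5) unfolding h_def inj_on_def by (auto split: if_splits)
    then show ?thesis
      using assms(2,3,5) by (auto simp: irreflp_def dest: sympD)
  qed
  moreover have "h ` (K \<union> W) \<subseteq> {0..<card K}"
    using c assms(5) by (auto simp: h_def bij_betw_def)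
  then have "card (h ` (K \<union> W)) \<le> card K"
    using card_mono[of "{0..<card K}"] by fastforce
  ultimately show ?thesis
    unfolding set_colourable_def by blast
qed

section \<open>Covering the complement by edges and cycles\<close>

text \<open>Pairing consecutive, hence non-adjacent, elements uses half of \<open>L\<close> colours,
  rounded up. This is at most \<open>3 * L / 5\<close> for every \<open>L \<ge> 2\<close> except 3,
  with equality at 5. For \<open>L = 3\<close> the whole orbit is independent and one colour
  suffices.\<close>

lemma set_colourable_cycle:
  fixes p :: "'a \<Rightarrow> 'a" and L :: nat
  assumes "symp E" and "irreflp E" and "L \<ge> 2" and "(p ^^ L) x = x"
    and "inj_on (\<lambda>i. (p ^^ i) x) {..<L}"
    and "\<And>i. \<not> E ((p ^^ i) x) ((p ^^ Suc i) x)"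
  shows "\<exists>k. set_colourable E k ((\<lambda>i. (p ^^ i) x) ` {..<L}) \<and> 5 * k \<le> 3 * L"
proof (cases "L = 3")
  case True
  let ?e = "\<lambda>i. (p ^^ i) x"
  have "?e ` {..<L} = {?e 0, ?e 1, ?e 2}"
    using True by (auto simp: numeral_3_eq_3 numeral_2_eq_2 lessThan_Suc)
  moreover have "\<not> E (?e 0) (?e 1)" "\<not> E (?e 1) (?e 2)" "\<not> E (?e 2) (?e 0)"
    using assms(6)[of 0] assms(6)[of 1] assms(6)[of 2] assms(4) True
    by (auto simp: numeral_2_eq_2 numeral_3_eq_3)
  ultimately have "\<not> E u v" if "u \<in> ?e ` {..<L}" "v \<in> ?e ` {..<L}" for u v
    using that assms(1,2) unfolding symp_def irreflp_def by (simp; metis)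
  then have "set_colourable E 1 (?e ` {..<L})"
    unfolding set_colourable_def
    by (intro exI[of _ "\<lambda>_. 0"]) (auto simp: image_constant_conv)
  then show ?thesis
    using True by (intro exI[of _ 1]) auto
next
  case False
  let ?e = "\<lambda>i. (p ^^ i) x"
  define h where "h = (\<lambda>y. inv_into {..<L} ?e y div 2)"
  have h: "h (?e i) = i div 2" if "i < L" for i
    using inv_into_f_f[OF assms(5), of i] that by (simp add: h_def)
  have *: "\<not> E (?e i) (?e j) \<and> \<not> E (?e j) (?e i)" if "i < L" "j < L" "i div 2 = j div 2" "i \<le> j" for i j
  proof -
    have "j = i \<or> j = Suc i"
      using that by linarith
    then show ?thesis
      using assms(1,2) assms(6)[of i] unfolding symp_def irreflp_def by metis
  qed
  have "\<not> E u v" if uv: "u \<in> ?e ` {..<L}" "v \<in> ?e ` {..<L}" "h u = h v" for u v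
  proof -
    obtain i j where "u = ?e i" "v = ?e j" "i < L" "j < L"
      using uv by auto
    then show ?thesis
      using uv(3) h *[of i j] *[of j i] by (cases "i \<le> j") auto
  qed
  moreover have "h ` ?e ` {..<L} \<subseteq> {..<(L + 1) div 2}"
    using h by auto
  then have "card (h ` ?e ` {..<L}) \<le> (L + 1) div 2"
    using card_mono[of "{..<(L + 1) div 2}"] by fastforce
  ultimately have "set_colourable E ((L + 1) div 2) (?e ` {..<L})"
    unfolding set_colourable_def by blast
  moreover have "5 * ((L + 1) div 2) \<le> 3 * L"
    using False assms(3) by presburger
  ultimately show ?thesis
    by blast
qed

text \<open>The cycles of \<open>p\<close> on \<open>S\<close> are split off one at a time. Each has
  length at least 2, as \<open>p\<close> has no fixed point in \<open>S\<close>, and what remains of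
  \<open>S\<close> is again invariant.\<close>

lemma set_colourable_permutation:
  fixes p :: "'a \<Rightarrow> 'a"
  assumes "finite S" and "inj p" and "p ` S \<subseteq> S" and "symp E" and "irreflp E"
    and "\<And>x. x \<in> S \<Longrightarrow> p x \<noteq> x \<and> \<not> E x (p x)"
  shows "\<exists>k. set_colourable E k S \<and> 5 * k \<le> 3 * card S"
  using assms(1,3,6)
proof (induction "card S" arbitrary: S rule: less_induct)
  case less
  show ?case
  proof (cases "S = {}")
    case True
    then show ?thesis
      by (intro exI[of _ 0]) (simp add: set_colourable_def)
  next
    case False
    then obtain x where x: "x \<in> S" by blast
    let ?e = "\<lambda>i. (p ^^ i) x"
    have e_S: "?e i \<in> S" for i
      using x less.prems(2) by (induction i) auto
    then have "finite {y. \<exists>n. y = ?e n}"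
      using less.prems(1) by (auto intro: finite_subset)
    then obtain n where n: "n > 0" "?e n = x"
      using funpow_inj_finite[OF assms(2)] by blast
    \<comment> \<open>With the least period the first \<open>L\<close> iterates are distinct: two
      equal ones would yield a smaller period by injectivity.\<close>
    define L where "L = (LEAST n. n > 0 \<and> ?e n = x)"
    have L: "L > 0" "?e L = x"
      unfolding L_def using LeastI[of "\<lambda>n. n > 0 \<and> ?e n = x" n] n by auto
    have L_min: "L \<le> m" if "m > 0" "?e m = x" for m
      unfolding L_def using that by (intro Least_le) auto
    have "L \<noteq> 1"
      using L(2) less.prems(3)[OF x] by auto
    then have L2: "L \<ge> 2"
      using L by simp
    have e_neq: "?e i \<noteq> ?e j" if "i < j" "j < L" for i j
    proof
      assume "?e i = ?e j"
      also have "?e j = (p ^^ i) (?e (j - i))"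
        using that by (metis funpow_add comp_apply le_add_diff_inverse less_imp_le_nat)
      finally have "?e (j - i) = x"
        using inj_fn[OF assms(2), of i] by (metis injD)
      then show False
        using L_min[of "j - i"] that by simp
    qed
    have inj: "inj_on ?e {..<L}"
      using e_neq by (intro inj_onI) (metis lessThan_iff linorder_neqE_nat)
    let ?O = "?e ` {..<L}"
    obtain k where k: "set_colourable E k ?O" "5 * k \<le> 3 * L"
      using set_colourable_cycle[OF assms(4,5) L2 L(2) inj] e_S less.prems(3) by force
    have O: "?O \<subseteq> S" "card ?O = L"
      using e_S card_image[OF inj] by auto
    have card: "card (S - ?O) = card S - L" "L \<le> card S"
      using O less.prems(1) by (metis card_Diff_subset finite_subset, metis card_mono)
    have "p y \<in> S - ?O" if y: "y \<in> S - ?O" for y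
    proof -
      have "p y \<notin> ?O"
      proof
        assume "p y \<in> ?O"
        then obtain i where i: "p y = ?e i" "i < L" by auto
        \<comment> \<open>\<open>j\<close> is the cyclic predecessor of \<open>i\<close>, so
          injectivity of \<open>p\<close> puts \<open>y\<close> itself on the orbit.\<close>
        define j where "j = (if i = 0 then L - 1 else i - 1)"
        have "?e (Suc j) = ?e i" "j < L"
          using L i by (auto simp: j_def simp del: funpow.simps)
        then have "p y = p (?e j)"
          using i by simp
        then have "y = ?e j"
          using assms(2) by (metis injD)
        then show False
          using y \<open>j < L\<close> by auto
      qed
      then show ?thesis
        using y less.prems(2) by auto
    qed
    then have "p ` (S - ?O) \<subseteq> S - ?O"
      by (rule image_subsetI)
    moreover have "card (S - ?O) < card S"
      using card L by linarith
    moreover have "finite (S - ?O)"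
      using less.prems(1) by simp
    ultimately have "\<exists>l. set_colourable E l (S - ?O) \<and> 5 * l \<le> 3 * card (S - ?O)"
      using less.prems(3) by (intro less.hyps) simp_all
    then obtain l where l: "set_colourable E l (S - ?O)" "5 * l \<le> 3 * card (S - ?O)"
      by blast
    have O_Un: "?O \<union> (S - ?O) = S"
      using O(1) by blast
    have "set_colourable E (k + l) S"
      using set_colourable_Un[OF k(1) l(1)] less.prems(1) unfolding O_Un by blast
    moreover have "5 * (k + l) \<le> 3 * card S"
    proof -
      have "card S = L + card (S - ?O)"
        using card by simp
      moreover have "5 * (k + l) \<le> 3 * (L + card (S - ?O))"
        using k(2) l(2) unfolding distrib_left by (rule add_mono)
      ultimately show ?thesis
        by simp
    qed
    ultimately show ?thesis
      by blast
  qed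
qed

section \<open>A neighbourhood of large chromatic number\<close>

text \<open>Failure of \<open>k\<close> colours means chromatic number at least
  \<open>k + 1\<close>; the conclusion says that the neighbourhood of \<open>v\<close> loses at most
  one from this bound.\<close>

lemma ex_neighbourhood_not_colourable:
  assumes "finite V" and "symp E" and "irreflp E"
    and "\<not> set_colourable E k V" and "3 * card V < 5 * (k + 1)"
  shows "\<exists>v\<in>V. \<forall>j. set_colourable E j {w \<in> V. E v w} \<longrightarrow> k \<le> j"
proof -
  define N where "N = (\<lambda>X. {y \<in> V. \<exists>x\<in>X. x \<noteq> y \<and> \<not> E x y})"
  have finN: "finite (N X)" for X
    using assms(1) by (simp add: N_def)
  have "\<exists>X\<subseteq>V. card (N X) < card X"
  proof (rule ccontr)
    assume "\<not> ?thesis"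
    moreover have "N J = (\<Union>x\<in>J. N {x})" for J
      by (auto simp: N_def)
    ultimately have "card J \<le> card (\<Union>x\<in>J. N {x})" if "J \<subseteq> V" for J
      using that by (metis not_less)
    then have "\<exists>f. inj_on f V \<and> (\<forall>x\<in>V. f x \<in> N {x})"
      by (intro hall_marriage[OF assms(1) finN])
    then obtain f where f: "inj_on f V" "\<forall>x\<in>V. f x \<in> N {x}"
      by blast
    then have fV: "f ` V = V"
      using endo_inj_surj[OF assms(1), of f] by (auto simp: N_def)
    \<comment> \<open>The identity outside \<open>V\<close> makes the map injective on the whole
      type, as iterating it requires.\<close>
    define p where "p = (\<lambda>x. if x \<in> V then f x else x)"
    have "inj p"
      using f(1) fV unfolding p_def inj_on_def by (auto split: if_splits)
    moreover have "p ` V \<subseteq> V"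
      using fV by (auto simp: p_def)
    moreover have "p x \<noteq> x \<and> \<not> E x (p x)" if "x \<in> V" for x
      using f(2) that by (auto simp: p_def N_def)
    ultimately obtain l where "set_colourable E l V" "5 * l \<le> 3 * card V"
      using set_colourable_permutation[OF assms(1)] assms(2,3) by blast
    moreover from this have "5 * l < 5 * (k + 1)"
      using assms(5) by linarith
    then have "l \<le> k"
      by simp
    ultimately show False
      using assms(1,4) set_colourable_mono by blast
  qed
  then obtain X0 where X0: "X0 \<subseteq> V" "card (N X0) < card X0"
    by blast
  \<comment> \<open>This is the deficiency of Hall's condition, taken in the integers because it may
    be negative.\<close>
  define d where "d = (\<lambda>X. int (card X) - int (card (N X)))"
  have "finite (d ` Pow V)"
    using assms(1) by simp
  then have "\<exists>X\<in>Pow V. d X = Max (d ` Pow V)"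
    using Max_in[of "d ` Pow V"] by (metis Pow_bottom empty_iff image_iff)
  then obtain X where X: "X \<subseteq> V" "\<And>Y. Y \<subseteq> V \<Longrightarrow> d Y \<le> d X"
    using Max_ge[OF \<open>finite (d ` Pow V)\<close>] by (metis Pow_iff imageI)
  have dX: "d X > 0"
    using X(2)[OF X0(1)] X0(2) by (simp add: d_def)
  \<comment> \<open>The clique \<open>K\<close> is joined completely to \<open>Z\<close>, and maximality of the deficiency matches \<open>W\<close> into
    \<open>K\<close>, so the colours of \<open>K\<close> suffice for \<open>K \<union> W\<close>.\<close>
  define K where "K = X - N X"
  define W where "W = N K"
  define Z where "Z = V - K - W"
  have KV: "K \<subseteq> V" and WV: "W \<subseteq> V"
    using X by (auto simp: K_def W_def N_def)
  have fin: "finite K" "finite W" "finite Z"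
    using KV WV assms(1) by (auto simp: Z_def intro: finite_subset)
  have K_max: "d Y \<le> d K" if "Y \<subseteq> V" for Y
  proof -
    \<comment> \<open>A \<open>y \<in> X\<close> not adjacent to some other \<open>x \<in> K\<close>
      would put \<open>x\<close> into \<open>N X\<close>. Hence passing from \<open>X\<close> to
      \<open>K\<close> removes \<open>X \<inter> N X\<close> from \<open>X\<close> and at least as
      much from \<open>N X\<close>, and the deficiency does not drop.\<close>
    have "N K \<subseteq> N X - X"
    proof
      fix y
      assume "y \<in> N K"
      then obtain x where "x \<in> X" "x \<notin> N X" "x \<noteq> y" "\<not> E x y" "y \<in> V"
        by (auto simp: N_def K_def)
      moreover from this have "\<not> E y x" "x \<in> V"
        using assms(2) X(1) by (auto dest: sympD)
      ultimately show "y \<in> N X - X"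
        unfolding N_def by auto
    qed
    then have "card (N K) \<le> card (N X - X)"
      using finN by (simp add: card_mono)
    also have "\<dots> = card (N X) - card (X \<inter> N X)"
      using finN by (metis card_Diff_subset_Int finite_Int inf_commute)
    finally have "card (N K) \<le> card (N X) - card (X \<inter> N X)" .
    moreover have "card K = card X - card (X \<inter> N X)"
      unfolding K_def using X assms(1) by (metis card_Diff_subset_Int finite_Int finN)
    moreover have "card (X \<inter> N X) \<le> card X" "card (X \<inter> N X) \<le> card (N X)"
      using X assms(1) finN by (auto intro!: card_mono finite_subset[OF X(1)])
    ultimately have "d X \<le> d K"
      by (simp add: d_def)
    then show ?thesis
      using X(2)[OF that] by simp
  qed
  have KW: "K \<inter> W = {}"
    using assms(2) by (auto simp: K_def W_def N_def symp_def)
  have join: "E x y" if "x \<in> K" "y \<in> K \<union> Z" "x \<noteq> y" for x y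
    using that KV KW by (auto simp: Z_def W_def N_def)
  have "K \<noteq> {}"
    using K_max[OF X(1)] dX by (auto simp: d_def)
  then obtain v where v: "v \<in> K" by blast
  define M where "M = (\<lambda>w. {x \<in> K. \<not> E x w})"
  \<comment> \<open>If \<open>J\<close> had too few partners, deleting them from \<open>K\<close>
    would remove all of \<open>J\<close> from \<open>N K\<close> and raise the deficiency.\<close>
  have "card J \<le> card (\<Union>(M ` J))" if J: "J \<subseteq> W" for J
  proof -
    let ?U = "\<Union>(M ` J)"
    have U: "?U \<subseteq> K"
      by (auto simp: M_def)
    have "N (K - ?U) \<subseteq> W - J"
      using J by (auto simp: M_def W_def N_def)
    then have "card (N (K - ?U)) \<le> card (W - J)"
      using fin by (simp add: card_mono)
    also have "\<dots> = card W - card J"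
      using J fin by (metis card_Diff_subset finite_subset)
    finally have "card (N (K - ?U)) \<le> card W - card J" .
    moreover have "card J \<le> card W"
      using J fin by (simp add: card_mono)
    moreover have "card (K - ?U) = card K - card ?U" "card ?U \<le> card K"
      using U fin by (metis card_Diff_subset finite_subset, metis card_mono)
    moreover have "d (K - ?U) \<le> d K"
      using KV by (intro K_max) auto
    ultimately show ?thesis
      by (simp add: d_def W_def)
  qed
  moreover have "finite (M w)" for w
    using fin by (simp add: M_def)
  ultimately have "\<exists>f. inj_on f W \<and> (\<forall>w\<in>W. f w \<in> M w)"
    by (intro hall_marriage[OF fin(2)])
  then obtain f where f: "inj_on f W" "\<forall>w\<in>W. f w \<in> M w"
    by blast
  have KW_col: "set_colourable E (card K) (K \<union> W)"
    using f by (intro set_colourable_matched[OF fin(1) assms(3,2) f(1) _ KW]) (auto simp: M_def)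
  \<comment> \<open>The neighbourhood of \<open>v\<close> contains the join of
    \<open>K - {v}\<close> and \<open>Z\<close>, so \<open>Z\<close> needs at most
    \<open>j - (card K - 1)\<close> colours. Together with \<open>card K\<close> colours for
    \<open>K \<union> W\<close> this colours \<open>V\<close> with \<open>j + 1\<close>.\<close>
  have "k \<le> j" if j: "set_colourable E j {w \<in> V. E v w}" for j
  proof -
    have "set_colourable E j ((K - {v}) \<union> Z)"
      using join[OF v] KV assms(1) v
      by (intro set_colourable_mono[OF j]) (auto simp: Z_def)
    then have "card (K - {v}) \<le> j" "set_colourable E (j - card (K - {v})) Z"
      using set_colourable_join[of E j "K - {v}" Z] fin join by (auto simp: Z_def)
    moreover have "card K = card (K - {v}) + 1"
      using v fin by (metis Suc_eq_plus1 card.remove)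
    moreover have "K \<union> W \<union> Z = V"
      using KV WV by (auto simp: Z_def)
    ultimately have "set_colourable E (j + 1) V"
      using set_colourable_Un[OF KW_col, of _ Z] fin by fastforce
    then show ?thesis
      using assms(1,4) set_colourable_mono[of E "j + 1" V V k] by force
  qed
  then show ?thesis
    using v KV by blast
qed

section \<open>Translation to induced subgraphs and \<phi>\<close>

lemma dominates_induce_subgraph_iff:
  "u \<rightarrow>\<^bsub>G \<restriction> S\<^esub> v \<longleftrightarrow> u \<in> S \<and> v \<in> S \<and> u \<rightarrow>\<^bsub>G\<^esub> v"
  by (auto simp: arcs_ends_def arc_to_ends_def induce_subgraph_def)

text \<open>One side bounds the values of the colours and the other their number; renumbering the
  colours used by an initial segment reconciles them.\<close>

lemma colourable_induce_subgraph:
  assumes "finite S"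
  shows "colourable k (G \<restriction> S) \<longleftrightarrow> set_colourable (\<lambda>u v. u \<rightarrow>\<^bsub>G\<^esub> v) k S"
proof
  assume "colourable k (G \<restriction> S)"
  then obtain f where f: "proper_colouring (G \<restriction> S) f" "f ` S \<subseteq> {..<k}"
    by (auto simp: colourable_def)
  then have "card (f ` S) \<le> k"
    using card_mono[of "{..<k}" "f ` S"] by simp
  with f show "set_colourable (\<lambda>u v. u \<rightarrow>\<^bsub>G\<^esub> v) k S"
    unfolding set_colourable_def proper_colouring_def
    by (intro exI[of _ f]) (simp add: dominates_induce_subgraph_iff)
next
  assume "set_colourable (\<lambda>u v. u \<rightarrow>\<^bsub>G\<^esub> v) k S"
  then obtain f :: "'a \<Rightarrow> nat"
    where f: "\<forall>u\<in>S. \<forall>v\<in>S. u \<rightarrow>\<^bsub>G\<^esub> v \<longrightarrow> f u \<noteq> f v" "card (f ` S) \<le> k"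
    by (auto simp: set_colourable_def)
  obtain b where b: "bij_betw b (f ` S) {0..<card (f ` S)}"
    using ex_bij_betw_finite_nat[of "f ` S"] assms by blast
  have "(b \<circ> f) ` S = {0..<card (f ` S)}"
    using b by (simp add: bij_betw_def image_comp)
  then have "(b \<circ> f) ` S \<subseteq> {..<k}"
    using f(2) by auto
  moreover have "proper_colouring (G \<restriction> S) (b \<circ> f)"
    using f(1) b unfolding proper_colouring_def bij_betw_def inj_on_def
    by (auto simp: dominates_induce_subgraph_iff)
  ultimately show "colourable k (G \<restriction> S)"
    unfolding colourable_def by (intro exI[of _ "b \<circ> f"]) simp
qed

lemma chromatic_number_induce_subgraph_le_iff:
  assumes "graph G" and "finite S"
  shows "chromatic_number (G \<restriction> S) \<le> k \<longleftrightarrow> set_colourable (\<lambda>u v. u \<rightarrow>\<^bsub>G\<^esub> v) k S"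
proof
  interpret graph G by fact
  have "irreflp (\<lambda>u v. u \<rightarrow>\<^bsub>G\<^esub> v)"
    using adj_not_same by (auto simp: irreflp_def)
  then have "colourable (card S) (G \<restriction> S)"
    using set_colourable_card assms(2) by (simp add: colourable_induce_subgraph)
  then have "colourable (chromatic_number (G \<restriction> S)) (G \<restriction> S)"
    unfolding chromatic_number_def by (rule LeastI)
  then show "set_colourable (\<lambda>u v. u \<rightarrow>\<^bsub>G\<^esub> v) k S" if "chromatic_number (G \<restriction> S) \<le> k"
    using set_colourable_mono that assms(2) by (metis colourable_induce_subgraph order_refl)
next
  assume "set_colourable (\<lambda>u v. u \<rightarrow>\<^bsub>G\<^esub> v) k S"
  then show "chromatic_number (G \<restriction> S) \<le> k"
    unfolding chromatic_number_def using assms(2)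
    by (intro Least_le) (simp add: colourable_induce_subgraph)
qed

lemma chromatic_number_le_iff:
  assumes "graph G"
  shows "chromatic_number G \<le> k \<longleftrightarrow> set_colourable (\<lambda>u v. u \<rightarrow>\<^bsub>G\<^esub> v) k (verts G)"
proof -
  interpret graph G by fact
  have "colourable l (G \<restriction> verts G) \<longleftrightarrow> colourable l G" for l
    by (simp add: colourable_def proper_colouring_def dominates_induce_subgraph_iff)
  then have "chromatic_number (G \<restriction> verts G) = chromatic_number G"
    by (simp add: chromatic_number_def)
  then show ?thesis
    using chromatic_number_induce_subgraph_le_iff[OF assms finite_verts] by metis
qed

text \<open>\<open>G \<restriction> S\<close> is one of the subgraphs in the maximum, and its
  chromatic number is at most \<open>j\<close>.\<close>

lemma phi_colouring_ge:
  assumes "graph G" and "S \<subseteq> verts G" and "S \<noteq> {}"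
    and "set_colourable (\<lambda>u v. u \<rightarrow>\<^bsub>G\<^esub> v) j S"
  shows "int (card (\<sigma> ` S)) - int j \<le> phi_colouring G \<sigma>"
proof -
  interpret graph G by fact
  have "chromatic_number (G \<restriction> S) \<le> j"
    using assms by (simp add: chromatic_number_induce_subgraph_le_iff finite_subset)
  moreover have "induced_subgraph (G \<restriction> S) G"
    using assms(2) by (rule induced_induce)
  then have "int (card (\<sigma> ` verts (G \<restriction> S))) - int (chromatic_number (G \<restriction> S)) \<le> phi_colouring G \<sigma>"
    unfolding phi_colouring_def using assms
    by (intro Max_ge phi_colouring_set(1) CollectI exI[of _ "G \<restriction> S"]) auto
  ultimately show ?thesis
    by simp
qed

section \<open>Dominating vertices and the bound on \<phi>\<close>

text \<open>Otherwise every vertex of colour \<open>i\<close> could move to another colour missing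
  from its neighbourhood. The class is independent, so simultaneous moves do not conflict, and
  colour \<open>i\<close> disappears.\<close>

lemma ex_colour_dominating_vertex:
  assumes "finite V" and "symp E" and "\<And>u v. u \<in> V \<Longrightarrow> v \<in> V \<Longrightarrow> E u v \<Longrightarrow> \<sigma> u \<noteq> (\<sigma> v :: nat)"
    and "\<not> set_colourable E (card (\<sigma> ` V) - 1) V" and "i \<in> \<sigma> ` V"
  shows "\<exists>v\<in>V. \<sigma> v = i \<and> \<sigma> ` V - {i} \<subseteq> \<sigma> ` {w \<in> V. E v w}"
proof (rule ccontr)
  assume "\<not> ?thesis"
  then have "\<forall>v\<in>V. \<exists>j. \<sigma> v = i \<longrightarrow> j \<in> \<sigma> ` V - {i} \<and> j \<notin> \<sigma> ` {w \<in> V. E v w}"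
    by blast
  then obtain g where g: "\<And>v. v \<in> V \<Longrightarrow> \<sigma> v = i \<Longrightarrow> g v \<in> \<sigma> ` V - {i}"
      "\<And>v. v \<in> V \<Longrightarrow> \<sigma> v = i \<Longrightarrow> g v \<notin> \<sigma> ` {w \<in> V. E v w}"
    by metis
  define f where "f = (\<lambda>v. if \<sigma> v = i then g v else \<sigma> v)"
  have "f u \<noteq> f v" if "u \<in> V" "v \<in> V" "E u v" for u v
  proof -
    have "E v u"
      using assms(2) that(3) by (rule sympD)
    then have "\<sigma> u = i \<Longrightarrow> g u \<noteq> \<sigma> v" "\<sigma> v = i \<Longrightarrow> g v \<noteq> \<sigma> u"
      using that g(2)[of u] g(2)[of v] by blast+
    then show ?thesis
      using assms(3)[OF that] unfolding f_def by auto
  qed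
  moreover have "f ` V \<subseteq> \<sigma> ` V - {i}"
    using g(1) by (auto simp: f_def)
  then have "card (f ` V) \<le> card (\<sigma> ` V - {i})"
    using assms(1) by (intro card_mono) auto
  then have "card (f ` V) \<le> card (\<sigma> ` V) - 1"
    using assms(5) by simp
  ultimately show False
    using assms(4) unfolding set_colourable_def by blast
qed

theorem theorem4p6:
  fixes G :: "('a, 'b) pre_digraph" and s :: nat
  assumes "s \<ge> 3"
    and "graph G" and "verts G \<noteq> {}"
    and "co_locally_colourable (s - 1) G"
    and "\<not> complete_digraph s G"
    and "real (chromatic_number G) < (5 * real s + 2) / 3"
  shows "phi G \<ge> int (chromatic_number G) - int s + 1"
proof (rule ccontr)
  assume neg: "\<not> ?thesis"
  interpret graph G by fact
  define E where "E = (\<lambda>u v. u \<rightarrow>\<^bsub>G\<^esub> v)"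
  define V where "V = verts G"
  define c where "c = chromatic_number G"
  have V: "finite V" "V \<noteq> {}"
    using assms(3) by (simp_all add: V_def)
  have E: "symp E" "irreflp E"
    using adj_not_same by (auto simp: E_def symp_def irreflp_def intro: graph_symmetric)
  have c_le: "c \<le> j" if "set_colourable E j V" for j
    using that assms(2) by (simp add: chromatic_number_le_iff c_def V_def E_def)
  have "phi G \<in> {phi_colouring G \<sigma> | \<sigma>. proper_colouring G \<sigma>}"
    unfolding phi_def using phi_set[OF assms(2,3)] by (intro Min_in)
  then obtain \<sigma> where \<sigma>: "proper_colouring G \<sigma>" "phi G = phi_colouring G \<sigma>"
    by blast
  have \<sigma>_proper: "\<sigma> u \<noteq> \<sigma> v" if "u \<in> V" "v \<in> V" "E u v" for u v
    using that \<sigma>(1) by (simp add: proper_colouring_def V_def E_def)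
  have bound: "int (card (\<sigma> ` S)) - int j \<le> int c - int s"
    if "S \<subseteq> V" "S \<noteq> {}" "set_colourable E j S" for S j
    using phi_colouring_ge[OF assms(2), of S j \<sigma>] that neg \<sigma>(2) by (simp add: V_def E_def c_def)
  have colocal: "set_colourable E (s - 1) ({u} \<union> {w \<in> V. E v w})"
    if "u \<in> V" "v \<in> V" "u \<noteq> v" for u v
  proof -
    have "chromatic_number (G \<restriction> ({u} \<union> neighbourhood G v)) \<le> s - 1"
      using assms(4) that by (simp add: co_locally_colourable_def V_def)
    moreover have "neighbourhood G v = {w \<in> V. E v w}"
      by (simp add: neighbourhood_def V_def E_def)
    ultimately show ?thesis
      using chromatic_number_induce_subgraph_le_iff[OF assms(2)] V(1) by (simp add: E_def)
  qed
  define k where "k = card (\<sigma> ` V)"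
  have "set_colourable E k V"
    unfolding set_colourable_def k_def using \<sigma>_proper by blast
  then have ck: "c \<le> k"
    by (rule c_le)
  obtain x where x: "x \<in> V"
    using V by blast
  \<comment> \<open>A single vertex gives \<open>1 - 1 \<le> c - s\<close>.\<close>
  have sc: "s \<le> c"
    using bound[of "{x}" 1] x set_colourable_card[of "{x}" E] E by simp
  show False
  proof (cases "k = c")
    case True
    have not_col: "\<not> set_colourable E (card (\<sigma> ` V) - 1) V"
      using c_le[of "k - 1"] True sc assms(1) by (auto simp: k_def)
    note dominating = ex_colour_dominating_vertex[OF V(1) E(1) \<sigma>_proper not_col]
    have inj: "inj_on \<sigma> V"
    proof (rule inj_onI, rule ccontr)
      fix a b
      assume ab: "a \<in> V" "b \<in> V" "\<sigma> a = \<sigma> b" "a \<noteq> b"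
      then obtain v where v: "v \<in> V" "\<sigma> v = \<sigma> a" "\<sigma> ` V - {\<sigma> a} \<subseteq> \<sigma> ` {w \<in> V. E v w}"
        using dominating[of "\<sigma> a"] by auto
      \<comment> \<open>At least one of \<open>a\<close> and \<open>b\<close> differs from
        \<open>v\<close>.\<close>
      obtain u where u: "u \<in> V" "\<sigma> u = \<sigma> a" "u \<noteq> v"
        using ab by metis
      let ?S = "{u} \<union> {w \<in> V. E v w}"
      have "\<sigma> ` V \<subseteq> \<sigma> ` ?S"
        using u(2) v(3) by auto
      then have "\<sigma> ` ?S = \<sigma> ` V"
        using u(1) by auto
      then have "int k - int (s - 1) \<le> int c - int s"
        using bound[OF _ _ colocal[OF u(1) v(1) u(3)]] u(1) by (auto simp: k_def)
      then show False
        using True assms(1) by simp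
    qed
    have complete: "E a b" if ab: "a \<in> V" "b \<in> V" "a \<noteq> b" for a b
    proof -
      obtain v where v: "v \<in> V" "\<sigma> v = \<sigma> a" "\<sigma> ` V - {\<sigma> a} \<subseteq> \<sigma> ` {w \<in> V. E v w}"
        using dominating[of "\<sigma> a"] ab by auto
      have "v = a"
        using inj v ab by (auto dest: inj_onD)
      have "\<sigma> b \<in> \<sigma> ` V - {\<sigma> a}"
        using inj ab by (auto dest: inj_onD)
      then have "\<sigma> b \<in> \<sigma> ` {w \<in> V. E a w}"
        using v(3) \<open>v = a\<close> by auto
      then obtain w where w: "w \<in> V" "E a w" "\<sigma> b = \<sigma> w"
        by auto
      then have "b = w"
        using inj_onD[OF inj w(3) ab(2) w(1)] by simp
      then show ?thesis
        using w(2) by simp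
    qed
    have card: "card V = c"
      using inj True by (simp add: k_def card_image)
    have "arcs_ends G = {(u, v). (u, v) \<in> verts G \<times> verts G \<and> u \<noteq> v}"
    proof (intro set_eqI iffI; clarify)
      fix a b
      assume "a \<rightarrow>\<^bsub>G\<^esub> b"
      then show "(a, b) \<in> verts G \<times> verts G \<and> a \<noteq> b"
        using adj_not_same adj_in_verts by blast
    next
      fix a b
      assume "a \<in> verts G" "b \<in> verts G" "a \<noteq> b"
      then show "a \<rightarrow>\<^bsub>G\<^esub> b"
        using complete[of a b] by (simp add: V_def E_def)
    qed
    then have "c \<noteq> s"
      using assms(2,5) card by (auto simp: complete_digraph_def V_def)
    \<comment> \<open>\<open>G\<close> is now complete on \<open>c > s\<close> vertices, so the
      neighbours of \<open>x\<close> form a clique of size at least \<open>s\<close>, against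
      co-local colourability. Any other vertex serves as \<open>u\<close>.\<close>
    have "V \<noteq> {x}"
      using card sc assms(1) by auto
    then obtain u where u: "u \<in> V" "u \<noteq> x"
      using x by blast
    have "V - {x} \<subseteq> {u} \<union> {w \<in> V. E x w}"
      using complete x by auto
    then have "set_colourable E (s - 1) ((V - {x}) \<union> {})"
      using set_colourable_mono[OF colocal[OF u(1) x u(2)]] V(1) by simp
    then have "card (V - {x}) \<le> s - 1"
      by (rule set_colourable_join(1)) (use V(1) complete in auto)
    then show False
      using card x sc assms(1) \<open>c \<noteq> s\<close> by simp
  next
    case False
    then have "c < k"
      using ck by simp
    obtain T where T: "T \<subseteq> V" "inj_on \<sigma> T" "\<sigma> ` T = \<sigma> ` V"
      using subset_image_inj[of "\<sigma> ` V" \<sigma> V] by auto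
    have cardT: "card T = k"
      using card_image[OF T(2)] T(3) by (simp add: k_def)
    have finT: "finite T"
      using T(1) V(1) by (rule finite_subset)
    \<comment> \<open>A colouring of \<open>T\<close> with \<open>m\<close> colours would give
      \<open>k - m = c - s + 1\<close>, one more than \<open>bound\<close> allows.\<close>
    define m where "m = k - c + (s - 1)"
    have m: "int m = int k - int c + int s - 1"
      using ck assms(1) by (simp add: m_def)
    have "T \<noteq> {}"
      using cardT \<open>c < k\<close> by auto
    then have "\<not> set_colourable E m T"
      using bound[of T m] T m by (auto simp: k_def)
    \<comment> \<open>With \<open>k = c + 1 + e\<close> and \<open>m = s + e\<close> the inequality
      is tightest at \<open>e = 0\<close>, where it is exactly \<open>3 * c < 5 * s + 2\<close>, the
      hypothesis on \<chi>.\<close>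
    moreover have "3 * card T < 5 * (m + 1)"
    proof -
      have "real (3 * c) < real (5 * s + 2)"
        using assms(6) by (simp add: c_def field_simps)
      then have "3 * c < 5 * s + 2"
        by (simp only: of_nat_less_iff)
      moreover obtain e where "k = Suc (c + e)"
        using less_imp_Suc_add[OF \<open>c < k\<close>] by blast
      moreover from this have "m = s + e"
        using assms(1) by (simp add: m_def)
      ultimately show ?thesis
        using cardT by simp
    qed
    ultimately obtain v where v: "v \<in> T"
      "\<And>j. set_colourable E j {w \<in> T. E v w} \<Longrightarrow> m \<le> j"
      using ex_neighbourhood_not_colourable[OF finT E] by blast
    have "T \<noteq> {v}"
      using cardT \<open>c < k\<close> sc assms(1) by auto
    then obtain u where u: "u \<in> T" "u \<noteq> v"
      using v(1) by blast
    have "set_colourable E (s - 1) ({u} \<union> {w \<in> V. E v w})"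
      using u v(1) T(1) by (intro colocal) auto
    then have "set_colourable E (s - 1) {w \<in> T. E v w}"
      by (rule set_colourable_mono) (use V(1) T(1) in auto)
    \<comment> \<open>This would force \<open>k \<le> c\<close>.\<close>
    then have "m \<le> s - 1"
      by (rule v(2))
    then show False
      using \<open>c < k\<close> by (simp add: m_def)
  qed
qed

end
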